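(* Let $\tilde{\Lambda}$ be the ring of eventually symmetric functions over $\mathbb{Q}$ in the variables $x_1,x_2,\ldots$. Then: (i) The variables $\{x_i\}_{i=1}^{\infty}$ together with the elementary symmetric functions $\{e_r\}_{r=1}^{\infty}$ form an algebraically independent set (over $\mathbb{Q}$). (ii) The ring $\mathbb{Q}[\mathbf{x}_\infty,\mathbf{e}_\infty]$ generated over $\mathbb{Q}$ by all the $x_i$ and all the $e_r$ is all of $\tilde{\Lambda}$. (iii) The action of $S_{\mathbb{N}}$, hence also that of $S_\infty$, on $\mathbb{Q}[[\mathbf{x}_\infty]]$ preserves $\tilde{\Lambda}$. (iv) A $\mathbb{Q}$-subspace of $\tilde{\Lambda}$ is a sub-representation with respect to the action of $S_\infty$ if and only if it is a sub-representation with respect to the action of $S_{\mathbb{N}}$.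
   Context: $\mathbb{N}=\{1,2,3,\ldots\}$. $\mathbb{Q}[[\mathbf{x}_\infty]]$ is the ring of formal power series over $\mathbb{Q}$ in infinitely many variables $x_1,x_2,\ldots$ (arbitrary, possibly infinite, formal $\mathbb{Q}$-linear combinations of monomials, each monomial involving finitely many variables). $S_{\mathbb{N}}$ is the group of all permutations of $\mathbb{N}$, acting on $\mathbb{Q}[[\mathbf{x}_\infty]]$ by permuting the variables. $S_n$ is embedded in $S_{\mathbb{N}}$ as the subgroup fixing every $m>n$, and $S_\infty=\bigcup_{n\geq1}S_n$. $S_{\mathbb{N}}^{(n)}$ is the subgroup of $S_{\mathbb{N}}$ fixing each of $1,\ldots,n$. A series $F\in\mathbb{Q}[[\mathbf{x}_\infty]]$ is called eventually symmetric if its degree is bounded and it is fixed by $S_{\mathbb{N}}^{(n)}$ for some $n$; $\tilde{\Lambda}$ is the set of all eventually symmetric series (it is a subring of $\mathbb{Q}[[\mathbf{x}_\infty]]$). $e_r=\sum_{i_1<\cdots<i_r}x_{i_1}\cdots x_{i_r}$ is the $r$th elementary symmetric function in all the variables. *)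

theory Defs
  imports Complex_Main "HOL-Library.Poly_Mapping" "HOL-Combinatorics.Permutations"
begin

section \<open>Formal power series in arbitrarily many variables\<close>

text \<open>
  A monomial in the variables indexed by \<open>'v\<close> is its finitely supported exponent
  function \<open>'v \<Rightarrow>\<^sub>0 nat\<close>; multiplying monomials is adding exponents. A formal power
  series is an arbitrary assignment of coefficients to monomials.
\<close>

typedef ('v, 'a) mfps = "UNIV :: (('v \<Rightarrow>\<^sub>0 nat) \<Rightarrow> 'a) set"
  morphisms mcoeff Mfps
  by simp

lemma mcoeff_Mfps [simp]: "mcoeff (Mfps f) = f"
  by (simp add: Mfps_inverse)

lemma mfps_eqI: "(\<And>m. mcoeff F m = mcoeff G m) \<Longrightarrow> F = G"
  by (metis ext mcoeff_inject)

lemma finite_monomial_splittings: "finite {(a, b). a + b = (m :: 'v \<Rightarrow>\<^sub>0 nat)}"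
proof -
  let ?l = "Poly_Mapping.lookup"
  let ?A = "Poly_Mapping.keys m" and ?B = "\<Union>x\<in>Poly_Mapping.keys m. {..?l m x}"
  define S where "S = {f. \<forall>x. (x \<in> ?A \<longrightarrow> f x \<in> ?B) \<and> (x \<notin> ?A \<longrightarrow> f x = (0::nat))}"
  have "finite S"
    unfolding S_def by (rule finite_set_of_finite_funs) auto
  moreover have "?l a \<in> S" if "a + b = m" for a b
  proof -
    have *: "?l m x = ?l a x + ?l b x" for x
      using that by (auto simp: lookup_add)
    have "?l a x \<in> ?B" if "x \<in> ?A" for x
      using that * by (intro UN_I [where a = x]) auto
    moreover have "?l a x = 0" if "x \<notin> ?A" for x
      using that * by (simp add: in_keys_iff)
    ultimately show ?thesis
      by (simp add: S_def)
  qed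
  then have "?l ` {a. \<exists>b. a + b = m} \<subseteq> S"
    by blast
  ultimately have "finite (?l ` {a. \<exists>b. a + b = m})"
    using finite_subset by blast
  then have fin: "finite {a. \<exists>b. a + b = m}"
    by (rule finite_imageD) (simp add: inj_on_def)
  have "{(a, b). a + b = m} \<subseteq> (\<lambda>a. (a, m - a)) ` {a. \<exists>b. a + b = m}"
    by force
  then show ?thesis
    using fin finite_subset by blast
qed

instantiation mfps :: (type, comm_ring_1) comm_ring_1
begin

definition zero_mfps :: "('a, 'b) mfps" where
  "0 = Mfps (\<lambda>m. 0)"

definition one_mfps :: "('a, 'b) mfps" where
  "1 = Mfps (\<lambda>m. if m = 0 then 1 else 0)"

definition plus_mfps :: "('a, 'b) mfps \<Rightarrow> ('a, 'b) mfps \<Rightarrow> ('a, 'b) mfps" where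
  "F + G = Mfps (\<lambda>m. mcoeff F m + mcoeff G m)"

definition uminus_mfps :: "('a, 'b) mfps \<Rightarrow> ('a, 'b) mfps" where
  "- F = Mfps (\<lambda>m. - mcoeff F m)"

definition minus_mfps :: "('a, 'b) mfps \<Rightarrow> ('a, 'b) mfps \<Rightarrow> ('a, 'b) mfps" where
  "F - G = Mfps (\<lambda>m. mcoeff F m - mcoeff G m)"

definition times_mfps :: "('a, 'b) mfps \<Rightarrow> ('a, 'b) mfps \<Rightarrow> ('a, 'b) mfps" where
  "F * G = Mfps (\<lambda>m. \<Sum>(a, b) | a + b = m. mcoeff F a * mcoeff G b)"

instance
proof
  note defs = zero_mfps_def one_mfps_def plus_mfps_def uminus_mfps_def minus_mfps_def times_mfps_def
  fix F G H :: "('a, 'b) mfps"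
  show "F * G * H = F * (G * H)"
  proof (rule mfps_eqI)
    fix m :: "'a \<Rightarrow>\<^sub>0 nat"
    let ?S = "\<lambda>m :: 'a \<Rightarrow>\<^sub>0 nat. {(a, b). a + b = m}"
    have fin: "finite {p. fst p + snd p = u}" for u :: "'a \<Rightarrow>\<^sub>0 nat"
      using finite_monomial_splittings [of u] by (simp add: case_prod_unfold)
    have "mcoeff (F * G * H) m =
        (\<Sum>(u, c)\<in>?S m. \<Sum>(a, b)\<in>?S u. mcoeff F a * mcoeff G b * mcoeff H c)"
      by (simp add: defs case_prod_unfold sum_distrib_right)
    also have "\<dots> = (\<Sum>((u, c), (a, b))\<in>(SIGMA p : ?S m. ?S (fst p)).
        mcoeff F a * mcoeff G b * mcoeff H c)"
      by (subst sum.Sigma [symmetric]) (auto simp: fin case_prod_unfold)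
    also have "\<dots> = (\<Sum>((a, v), (b, c))\<in>(SIGMA p : ?S m. ?S (snd p)).
        mcoeff F a * (mcoeff G b * mcoeff H c))"
      by (rule sum.reindex_bij_witness [where
            i = "\<lambda>((a, v), (b, c)). ((a + b, c), (a, b))" and
            j = "\<lambda>((u, c), (a, b)). ((a, b + c), (b, c))"])
        (auto simp: ac_simps)
    also have "\<dots> = (\<Sum>(a, v)\<in>?S m. \<Sum>(b, c)\<in>?S v. mcoeff F a * (mcoeff G b * mcoeff H c))"
      by (subst sum.Sigma [symmetric]) (auto simp: fin case_prod_unfold)
    also have "\<dots> = mcoeff (F * (G * H)) m"
      by (simp add: defs case_prod_unfold sum_distrib_left)
    finally show "mcoeff (F * G * H) m = mcoeff (F * (G * H)) m" .
  qed
  show "F * G = G * F"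
  proof (rule mfps_eqI)
    fix m :: "'a \<Rightarrow>\<^sub>0 nat"
    have "(\<Sum>(a, b) | a + b = m. mcoeff F a * mcoeff G b)
        = (\<Sum>(a, b) | a + b = m. mcoeff G a * mcoeff F b)"
      by (rule sum.reindex_bij_witness [where i = prod.swap and j = prod.swap])
        (auto simp: ac_simps)
    then show "mcoeff (F * G) m = mcoeff (G * F) m"
      by (simp add: defs)
  qed
  show "1 * F = F"
  proof (rule mfps_eqI)
    fix m :: "'a \<Rightarrow>\<^sub>0 nat"
    have "(\<Sum>(a, b) | a + b = m. (if a = 0 then 1 else 0) * mcoeff F b)
        = (\<Sum>(a, b)\<in>{(0 :: 'a \<Rightarrow>\<^sub>0 nat, m)}. (if a = 0 then 1 else 0) * mcoeff F b)"
      by (rule sum.mono_neutral_right) (auto simp: finite_monomial_splittings split: if_splits)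
    then show "mcoeff (1 * F) m = mcoeff F m"
      by (simp add: defs)
  qed
  show "(F + G) * H = F * H + G * H"
    by (rule mfps_eqI) (simp add: defs case_prod_unfold sum.distrib distrib_right)
  show "F + G + H = F + (G + H)" "F + G = G + F" "0 + F = F" "- F + F = 0" "F - G = F + - G"
    by (simp_all add: defs ac_simps mcoeff_inverse)
  show "(0 :: ('a, 'b) mfps) \<noteq> 1"
    by (auto simp: defs Mfps_inject fun_eq_iff)
qed

end

definition mscale :: "'a::comm_ring_1 \<Rightarrow> ('v, 'a) mfps \<Rightarrow> ('v, 'a) mfps" where
  "mscale c F = Mfps (\<lambda>m. c * mcoeff F m)"

global_interpretation mfps: vector_space "mscale :: 'a::field \<Rightarrow> ('v, 'a) mfps \<Rightarrow> ('v, 'a) mfps"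
  by unfold_locales (simp_all add: mscale_def plus_mfps_def mcoeff_inverse algebra_simps)

definition mvar :: "'v \<Rightarrow> ('v, 'a::comm_ring_1) mfps" where
  "mvar i = Mfps (\<lambda>m. if m = Poly_Mapping.single i 1 then 1 else 0)"

text \<open>
  The coefficient of a monomial in the formal sum of the \<open>\<Prod>i\<in>A. x\<^sub>i\<close> over all
  \<open>r\<close>-element sets \<open>A\<close> of variables is the number of its occurrences as a summand.
\<close>

definition esym :: "nat \<Rightarrow> ('v, 'a::comm_ring_1) mfps" where
  "esym r = Mfps (\<lambda>m. of_nat (card {A. finite A \<and> card A = r \<and>
     (\<Sum>i\<in>A. Poly_Mapping.single i 1) = m}))"

definition mon_degree :: "('v \<Rightarrow>\<^sub>0 nat) \<Rightarrow> nat" where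
  "mon_degree m = (\<Sum>i\<in>Poly_Mapping.keys m. Poly_Mapping.lookup m i)"

definition bounded_degree :: "('v, 'a::comm_ring_1) mfps \<Rightarrow> bool" where
  "bounded_degree F \<longleftrightarrow> (\<exists>d. \<forall>m. mcoeff F m \<noteq> 0 \<longrightarrow> mon_degree m \<le> d)"

section \<open>Algebraic independence and generated subalgebras\<close>

text \<open>
  Polynomials in variables indexed by \<open>'i\<close> are elements of the ring
  \<open>('i \<Rightarrow>\<^sub>0 nat) \<Rightarrow>\<^sub>0 'a\<close>. Independence is that of the family \<open>(f i)\<close> with
  \<open>i \<in> I\<close>; in particular it forces \<open>f\<close> to be injective on \<open>I\<close>.
\<close>

definition poly_subst :: "('i \<Rightarrow> ('v, 'a::comm_ring_1) mfps) \<Rightarrow> (('i \<Rightarrow>\<^sub>0 nat) \<Rightarrow>\<^sub>0 'a) \<Rightarrow> ('v, 'a) mfps"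
  where "poly_subst f p = (\<Sum>m\<in>Poly_Mapping.keys p. mscale (Poly_Mapping.lookup p m)
     (\<Prod>i\<in>Poly_Mapping.keys m. f i ^ Poly_Mapping.lookup m i))"

definition algebraically_independent :: "'i set \<Rightarrow> ('i \<Rightarrow> ('v, 'a::comm_ring_1) mfps) \<Rightarrow> bool" where
  "algebraically_independent I f \<longleftrightarrow>
     (\<forall>p. (\<forall>m\<in>Poly_Mapping.keys p. Poly_Mapping.keys m \<subseteq> I) \<longrightarrow> poly_subst f p = 0 \<longrightarrow> p = 0)"

definition subalgebra :: "('v, 'a::field) mfps set \<Rightarrow> bool" where
  "subalgebra A \<longleftrightarrow> mfps.subspace A \<and> 1 \<in> A \<and> (\<forall>F\<in>A. \<forall>G\<in>A. F * G \<in> A)"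

section \<open>Permutation action and eventually symmetric series\<close>

text \<open>
  The permutation \<open>\<sigma>\<close> acts by \<open>x\<^sub>i \<mapsto> x\<^sub>\<sigma>\<^sub>(\<^sub>i\<^sub>)\<close>. The monomial sent to \<open>m\<close> is the one
  with exponent function \<open>m \<circ> \<sigma>\<close>.
\<close>

definition perm_act :: "('v \<Rightarrow> 'v) \<Rightarrow> ('v, 'a) mfps \<Rightarrow> ('v, 'a) mfps" where
  "perm_act \<sigma> F = Mfps (\<lambda>m. mcoeff F (Poly_Mapping.map_key \<sigma> m))"

lemma perm_act_mvar:
  assumes "bij \<sigma>"
  shows "perm_act \<sigma> (mvar i) = mvar (\<sigma> i)"
proof -
  have "Poly_Mapping.map_key \<sigma> m = Poly_Mapping.single i 1 \<longleftrightarrow> m = Poly_Mapping.single (\<sigma> i) 1"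
    for m :: "'a \<Rightarrow>\<^sub>0 nat"
  proof
    assume eq: "Poly_Mapping.map_key \<sigma> m = Poly_Mapping.single i 1"
    show "m = Poly_Mapping.single (\<sigma> i) 1"
    proof (rule poly_mapping_eqI)
      fix k
      have "Poly_Mapping.lookup (Poly_Mapping.map_key \<sigma> m) (inv \<sigma> k) =
          Poly_Mapping.lookup (Poly_Mapping.single i 1) (inv \<sigma> k)"
        by (simp add: eq)
      then have "Poly_Mapping.lookup m (\<sigma> (inv \<sigma> k)) =
          Poly_Mapping.lookup (Poly_Mapping.single i 1) (inv \<sigma> k)"
        using assms by (simp add: map_key.rep_eq bij_is_inj)
      then show "Poly_Mapping.lookup m k = Poly_Mapping.lookup (Poly_Mapping.single (\<sigma> i) 1) k"
        using assms by (auto simp: lookup_single when_def bij_is_surj surj_f_inv_f bij_is_inj)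
    qed
  next
    assume "m = Poly_Mapping.single (\<sigma> i) 1"
    then show "Poly_Mapping.map_key \<sigma> m = Poly_Mapping.single i 1"
      using assms by (simp add: map_key_single bij_is_inj)
  qed
  then show ?thesis
    by (simp add: perm_act_def mvar_def)
qed

definition invariant_under :: "('v \<Rightarrow> 'v) set \<Rightarrow> ('v, 'a) mfps set \<Rightarrow> bool" where
  "invariant_under S V \<longleftrightarrow> (\<forall>\<sigma>\<in>S. \<forall>F\<in>V. perm_act \<sigma> F \<in> V)"

text \<open>
  The positive integers are relabelled by \<open>nat\<close>: the type element \<open>i\<close> stands for the
  index \<open>i + 1\<close>, so that the indices \<open>1, \<dots>, n\<close> become \<open>{..<n}\<close> and those greater
  than \<open>n\<close> become \<open>{n..}\<close>.
\<close>

definition Sym_N :: "(nat \<Rightarrow> nat) set" where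
  "Sym_N = {\<sigma>. bij \<sigma>}"

definition Sym_upto :: "nat \<Rightarrow> (nat \<Rightarrow> nat) set" where
  "Sym_upto n = {\<sigma>. \<sigma> permutes {..<n}}"

definition Sym_inf :: "(nat \<Rightarrow> nat) set" where
  "Sym_inf = (\<Union>n\<in>{1..}. Sym_upto n)"

definition Sym_fixing :: "nat \<Rightarrow> (nat \<Rightarrow> nat) set" where
  "Sym_fixing n = {\<sigma> \<in> Sym_N. \<forall>i<n. \<sigma> i = i}"

definition eventually_symmetric :: "(nat, rat) mfps \<Rightarrow> bool" where
  "eventually_symmetric F \<longleftrightarrow>
     bounded_degree F \<and> (\<exists>n\<ge>1. \<forall>\<sigma>\<in>Sym_fixing n. perm_act \<sigma> F = F)"

definition ev_sym :: "(nat, rat) mfps set" where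
  "ev_sym = {F. eventually_symmetric F}"

end

theory Submission
  imports Defs
begin

text \<open>
  Fix \<open>n\<close> and compare monomials by their exponents on the variables of index at least \<open>n\<close>
  (the tail of the monomial), lexicographically with \<open>x\<^sub>n > x\<^sub>n\<^sub>+\<^sub>1 > \<dots>\<close>. For this preorder the
  monomial \<open>x\<^sub>n x\<^sub>n\<^sub>+\<^sub>1 \<cdots> x\<^sub>n\<^sub>+\<^sub>r\<^sub>-\<^sub>1\<close> lies strictly above every other monomial of \<open>e\<^sub>r\<close>
  (\<open>leading_esym\<close>), and the single monomial of \<open>x\<^sub>i\<close> does so trivially. Having coefficient 1 at
  a monomial strictly above all others is inherited by products (\<open>leading_mult\<close>). Hence every
  product \<open>x\<^sup>a e\<^sup>\<lambda>\<close>, with \<open>x\<^sup>a\<close> a monomial in the variables of index below \<open>n\<close>, has a leading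
  monomial, namely \<open>x\<^sup>a\<close> times a monomial in the remaining variables whose exponents decrease
  weakly and differ by the exponents \<open>\<lambda>\<^sub>r\<close>.

  Algebraic independence follows since \<open>(a, \<lambda>)\<close> can be read off from this leading monomial
  (\<open>leading_monomial_inject\<close>): among the terms of a nonzero polynomial in the \<open>x\<^sub>i\<close> and \<open>e\<^sub>r\<close>, one
  whose leading monomial has maximal tail cannot be cancelled by the others.

  For generation, let \<open>F\<close> have degree at most \<open>d\<close> and be fixed by the permutations that fix
  the indices below \<open>n\<close>. Permuting the tail exponents into decreasing order shows that \<open>F\<close> is
  determined by its coefficients at the dominant monomials, those with weakly decreasing tail
  (\<open>tail_symmetric_eq_0\<close>). There are only finitely many of these in degree at most \<open>d\<close>, and each
  of them is the leading monomial of some \<open>x\<^sup>a e\<^sup>\<lambda>\<close> (\<open>ex_leading_at_dominant\<close>). Subtracting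
  multiples of these products, from the largest tail downwards, reduces \<open>F\<close> to 0
  (\<open>tail_symmetric_in_subalgebra\<close>).

  The statements about the group actions rest on one remark: if \<open>F\<close> is fixed by the
  permutations that fix the indices below \<open>n\<close>, then \<open>\<sigma> F\<close> depends only on the values of
  \<open>\<sigma>\<close> below \<open>n\<close> (\<open>perm_act_eq_if_agree\<close>), and on these \<open>\<sigma>\<close> agrees with a permutation that
  moves only finitely many indices (\<open>bij_agrees_with_Sym_inf\<close>).
\<close>

section \<open>Coefficients and degrees\<close>

lemma mcoeff_simps [simp]:
  "mcoeff 0 m = 0"
  "mcoeff 1 m = (if m = 0 then 1 else 0)"
  "mcoeff (F + G) m = mcoeff F m + mcoeff G m"
  "mcoeff (F - G) m = mcoeff F m - mcoeff G m"
  "mcoeff (mscale c F) m = c * mcoeff F m"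
  "mcoeff (mvar i) m = (if m = Poly_Mapping.single i 1 then 1 else 0)"
  by (simp_all add: zero_mfps_def one_mfps_def plus_mfps_def minus_mfps_def mscale_def
      mvar_def)

lemma mcoeff_perm_act [simp]:
  "mcoeff (perm_act \<sigma> F) m = mcoeff F (Poly_Mapping.map_key \<sigma> m)"
  by (simp add: perm_act_def)

lemma mcoeff_mult: "mcoeff (F * G) m = (\<Sum>(a, b) | a + b = m. mcoeff F a * mcoeff G b)"
  by (simp add: times_mfps_def)

lemma mcoeff_sum: "mcoeff (sum F A) m = (\<Sum>i\<in>A. mcoeff (F i) m)"
  by (induction A rule: infinite_finite_induct) auto

lemma mcoeff_mult_nonzeroE:
  assumes "mcoeff (F * G) m \<noteq> 0"
  obtains a b where "a + b = m" "mcoeff F a \<noteq> 0" "mcoeff G b \<noteq> 0"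
proof -
  obtain p where "p \<in> {(a, b). a + b = m}" "(case p of (a, b) \<Rightarrow> mcoeff F a * mcoeff G b) \<noteq> 0"
    using assms unfolding mcoeff_mult by (meson sum.not_neutral_contains_not_neutral)
  then have "fst p + snd p = m" "mcoeff F (fst p) \<noteq> 0" "mcoeff G (snd p) \<noteq> 0"
    by (auto simp: case_prod_unfold)
  then show ?thesis
    by (rule that)
qed

lemma mon_degree_superset:
  assumes "finite A" "Poly_Mapping.keys m \<subseteq> A"
  shows "mon_degree m = (\<Sum>i\<in>A. Poly_Mapping.lookup m i)"
  unfolding mon_degree_def using assms
  by (intro sum.mono_neutral_left) (auto simp: in_keys_iff)

lemma mon_degree_add: "mon_degree (a + b) = mon_degree a + mon_degree b"
proof -
  let ?A = "Poly_Mapping.keys a \<union> Poly_Mapping.keys b"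
  have "mon_degree (a + b) = (\<Sum>i\<in>?A. Poly_Mapping.lookup (a + b) i)"
    by (rule mon_degree_superset) (auto dest: subsetD [OF Poly_Mapping.keys_add])
  also have "\<dots> = (\<Sum>i\<in>?A. Poly_Mapping.lookup a i) + (\<Sum>i\<in>?A. Poly_Mapping.lookup b i)"
    by (simp add: lookup_add sum.distrib)
  also have "\<dots> = mon_degree a + mon_degree b"
    using mon_degree_superset [of ?A a] mon_degree_superset [of ?A b] by simp
  finally show ?thesis .
qed

lemma mon_degree_0 [simp]: "mon_degree 0 = 0"
  by (simp add: mon_degree_def)

lemma mon_degree_single [simp]: "mon_degree (Poly_Mapping.single i k) = k"
  by (simp add: mon_degree_def)

lemma mon_degree_sum: "mon_degree (sum f A) = (\<Sum>i\<in>A. mon_degree (f i))"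
  by (induction A rule: infinite_finite_induct) (auto simp: mon_degree_add)

lemma lookup_map_key [simp]:
  "inj \<sigma> \<Longrightarrow> Poly_Mapping.lookup (Poly_Mapping.map_key \<sigma> m) i = Poly_Mapping.lookup m (\<sigma> i)"
  by (simp add: map_key.rep_eq)

lemma mon_degree_map_key:
  assumes "bij \<sigma>"
  shows "mon_degree (Poly_Mapping.map_key \<sigma> m) = mon_degree m"
  unfolding mon_degree_def
  by (rule sum.reindex_bij_witness [where i = "inv \<sigma>" and j = \<sigma>])
    (use assms in \<open>auto simp: keys_map_key bij_is_inj bij_is_surj surj_f_inv_f\<close>)

text \<open>Only monomials of total degree at most \<open>d\<close> occur in \<open>F\<close>; in particular \<open>0\<close> has degree
  at most \<open>d\<close> for every \<open>d\<close>.\<close>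

definition degree_le :: "nat \<Rightarrow> ('v, 'a::comm_ring_1) mfps \<Rightarrow> bool" where
  "degree_le d F \<longleftrightarrow> (\<forall>m. mcoeff F m \<noteq> 0 \<longrightarrow> mon_degree m \<le> d)"

lemma bounded_degree_iff: "bounded_degree F \<longleftrightarrow> (\<exists>d. degree_le d F)"
  by (simp add: bounded_degree_def degree_le_def)

lemma degree_le_mono: "degree_le d F \<Longrightarrow> d \<le> e \<Longrightarrow> degree_le e F"
  by (auto simp: degree_le_def)

lemma degree_le_basic:
  "degree_le d 0" "degree_le d 1" "degree_le 1 (mvar i)"
  by (auto simp: degree_le_def)

lemma degree_le_add: "degree_le d F \<Longrightarrow> degree_le d G \<Longrightarrow> degree_le d (F + G)"
  by (auto simp: degree_le_def) (metis add_0)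

lemma degree_le_diff: "degree_le d F \<Longrightarrow> degree_le d G \<Longrightarrow> degree_le d (F - G)"
  by (auto simp: degree_le_def) (metis diff_0_right)

lemma degree_le_mscale: "degree_le d F \<Longrightarrow> degree_le d (mscale c F)"
  unfolding degree_le_def mcoeff_simps by (metis mult_zero_right)

lemma degree_le_mult: "degree_le d F \<Longrightarrow> degree_le e G \<Longrightarrow> degree_le (d + e) (F * G)"
  unfolding degree_le_def
  by (auto elim!: mcoeff_mult_nonzeroE intro!: add_mono simp: mon_degree_add)

section \<open>Elementary symmetric series\<close>

lemma lookup_sum_single:
  "finite A \<Longrightarrow> Poly_Mapping.lookup (\<Sum>i\<in>A. Poly_Mapping.single i (1::nat)) j = of_bool (j \<in> A)"
  by (simp add: lookup_sum lookup_single when_def)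

lemma esym_nonzeroE:
  assumes "mcoeff (esym r) m \<noteq> 0"
  obtains A where "finite A" "card A = r" "m = (\<Sum>i\<in>A. Poly_Mapping.single i 1)"
proof -
  let ?S = "{A. finite A \<and> card A = r \<and> (\<Sum>i\<in>A. Poly_Mapping.single i 1) = m}"
  have "?S \<noteq> {}"
  proof
    assume "?S = {}"
    then have "card ?S = 0"
      by (simp only: card.empty)
    then show False
      using assms by (simp only: esym_def mcoeff_Mfps of_nat_0) simp
  qed
  then obtain A where "A \<in> ?S"
    by (meson ex_in_conv)
  then show ?thesis
    by (intro that [of A]) simp_all
qed

lemma sum_single_eq_iff:
  assumes "finite A" "finite B"
  shows "(\<Sum>i\<in>A. Poly_Mapping.single i (1::nat)) = (\<Sum>i\<in>B. Poly_Mapping.single i 1) \<longleftrightarrow> A = B"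
proof
  assume eq: "(\<Sum>i\<in>A. Poly_Mapping.single i (1::nat)) = (\<Sum>i\<in>B. Poly_Mapping.single i 1)"
  have "of_bool (j \<in> A) = (of_bool (j \<in> B) :: nat)" for j
    using lookup_sum_single [OF assms(1), of j] lookup_sum_single [OF assms(2), of j]
    by (simp only: eq)
  then show "A = B"
    unfolding of_bool_eq_iff by blast
qed simp

lemma mcoeff_esym_squarefree:
  assumes "finite A" "card A = r"
  shows "mcoeff (esym r) (\<Sum>i\<in>A. Poly_Mapping.single i 1) = 1"
proof -
  have "{B. finite B \<and> card B = r \<and>
      (\<Sum>i\<in>B. Poly_Mapping.single i (1::nat)) = (\<Sum>i\<in>A. Poly_Mapping.single i 1)} = {A}"
    using assms sum_single_eq_iff [OF _ assms(1)] by auto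
  then show ?thesis
    unfolding esym_def mcoeff_Mfps by (simp only: card.insert card.empty) simp
qed

lemma degree_le_esym: "degree_le r (esym r)"
  unfolding degree_le_def
proof (intro allI impI)
  fix m assume "mcoeff (esym r) m \<noteq> 0"
  then obtain A where "finite A" "card A = r" "m = (\<Sum>i\<in>A. Poly_Mapping.single i 1)"
    by (rule esym_nonzeroE)
  then show "mon_degree m \<le> r"
    by (simp add: mon_degree_sum)
qed

section \<open>The action of permutations\<close>

lemma perm_act_compose:
  assumes "inj \<sigma>" "inj \<tau>"
  shows "perm_act (\<sigma> \<circ> \<tau>) F = perm_act \<sigma> (perm_act \<tau> F)"
  using assms by (intro mfps_eqI) (simp add: map_key_compose)

lemma map_key_inv:
  assumes "bij \<sigma>"
  shows "Poly_Mapping.map_key (inv \<sigma>) (Poly_Mapping.map_key \<sigma> m) = m"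
    and "Poly_Mapping.map_key \<sigma> (Poly_Mapping.map_key (inv \<sigma>) m) = m"
  using assms
  by (auto intro!: poly_mapping_eqI simp: bij_is_inj bij_imp_bij_inv bij_is_surj surj_f_inv_f)

lemma perm_act_basic:
  "perm_act \<sigma> 0 = 0"
  "perm_act \<sigma> (F + G) = perm_act \<sigma> F + perm_act \<sigma> G"
  "perm_act \<sigma> (F - G) = perm_act \<sigma> F - perm_act \<sigma> G"
  "perm_act \<sigma> (mscale c F) = mscale c (perm_act \<sigma> F)"
  by (auto intro!: mfps_eqI)

lemma perm_act_one:
  assumes "bij \<sigma>"
  shows "perm_act \<sigma> 1 = 1"
proof -
  have "Poly_Mapping.map_key \<sigma> m = 0 \<longleftrightarrow> m = 0" for m :: "'a \<Rightarrow>\<^sub>0 nat"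
    using assms map_key_inv(1) [OF assms, of m]
    by (metis bij_imp_bij_inv bij_is_inj map_key_zero)
  then show ?thesis
    by (intro mfps_eqI) simp
qed

lemma perm_act_mult:
  assumes "bij \<sigma>"
  shows "perm_act \<sigma> (F * G) = perm_act \<sigma> F * perm_act \<sigma> G"
proof (rule mfps_eqI)
  fix m
  have inj: "inj \<sigma>" "inj (inv \<sigma>)"
    using assms by (auto simp: bij_is_inj bij_imp_bij_inv)
  show "mcoeff (perm_act \<sigma> (F * G)) m = mcoeff (perm_act \<sigma> F * perm_act \<sigma> G) m"
    unfolding mcoeff_perm_act mcoeff_mult
    by (rule sum.reindex_bij_witness [where
          j = "map_prod (Poly_Mapping.map_key (inv \<sigma>)) (Poly_Mapping.map_key (inv \<sigma>))" and
          i = "map_prod (Poly_Mapping.map_key \<sigma>) (Poly_Mapping.map_key \<sigma>)"])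
      (auto simp: map_key_inv [OF assms] map_key_plus [OF inj(1), symmetric]
        map_key_plus [OF inj(2), symmetric])
qed

lemma perm_act_esym:
  assumes "bij \<sigma>"
  shows "perm_act \<sigma> (esym r) = esym r"
proof (rule mfps_eqI)
  fix m
  let ?S = "\<lambda>m. {A. finite A \<and> card A = r \<and> (\<Sum>i\<in>A. Poly_Mapping.single i (1::nat)) = m}"
  have inj: "inj_on \<sigma> A" "inj_on (inv \<sigma>) A" for A
    using assms bij_is_inj bij_imp_bij_inv inj_on_subset subset_UNIV by metis+
  have image: "(\<Sum>i\<in>\<sigma> ` A. Poly_Mapping.single i (1::nat)) = m \<longleftrightarrow>
      (\<Sum>i\<in>A. Poly_Mapping.single i 1) = Poly_Mapping.map_key \<sigma> m" if "finite A" for A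
  proof -
    have "Poly_Mapping.map_key \<sigma> (\<Sum>i\<in>\<sigma> ` A. Poly_Mapping.single i (1::nat)) =
        (\<Sum>i\<in>A. Poly_Mapping.single i 1)"
      using assms that
      by (intro poly_mapping_eqI) (simp add: bij_is_inj lookup_sum_single inj_image_mem_iff del: One_nat_def)
    then show ?thesis
      using map_key_inv(1) [OF assms] by metis
  qed
  have "bij_betw (image \<sigma>) (?S (Poly_Mapping.map_key \<sigma> m)) (?S m)"
  proof (rule bij_betw_byWitness [where f' = "image (inv \<sigma>)"])
    show "\<forall>A\<in>?S (Poly_Mapping.map_key \<sigma> m). inv \<sigma> ` \<sigma> ` A = A"
      using assms by (simp add: image_image bij_is_inj)
    show "\<forall>A\<in>?S m. \<sigma> ` inv \<sigma> ` A = A"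
      using assms by (simp add: image_image bij_is_surj surj_f_inv_f)
    show "image \<sigma> ` ?S (Poly_Mapping.map_key \<sigma> m) \<subseteq> ?S m"
      by (auto simp: image card_image [OF inj(1)] simp del: One_nat_def)
    show "image (inv \<sigma>) ` ?S m \<subseteq> ?S (Poly_Mapping.map_key \<sigma> m)"
    proof (rule image_subsetI)
      fix A assume A: "A \<in> ?S m"
      then have "\<sigma> ` inv \<sigma> ` A = A"
        using assms by (simp add: image_image bij_is_surj surj_f_inv_f)
      then show "inv \<sigma> ` A \<in> ?S (Poly_Mapping.map_key \<sigma> m)"
        using A image [of "inv \<sigma> ` A"] by (simp add: card_image [OF inj(2)])
    qed
  qed
  then show "mcoeff (perm_act \<sigma> (esym r)) m = mcoeff (esym r) m"
    by (simp add: esym_def bij_betw_same_card)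
qed

lemma degree_le_perm_act: "bij \<sigma> \<Longrightarrow> degree_le d F \<Longrightarrow> degree_le d (perm_act \<sigma> F)"
  unfolding degree_le_def using mon_degree_map_key [of \<sigma>] by auto

text \<open>The series is fixed by all permutations of the variables that fix each index below \<open>n\<close>.
  Here \<open>n = 0\<close> is allowed and means full symmetry.\<close>

definition tail_symmetric :: "nat \<Rightarrow> (nat, 'a) mfps \<Rightarrow> bool" where
  "tail_symmetric n F \<longleftrightarrow> (\<forall>\<sigma>\<in>Sym_fixing n. perm_act \<sigma> F = F)"

lemma bij_Sym_fixing: "\<sigma> \<in> Sym_fixing n \<Longrightarrow> bij \<sigma>"
  by (simp add: Sym_fixing_def Sym_N_def)

lemma tail_symmetricI:
  "(\<And>\<sigma>. bij \<sigma> \<Longrightarrow> (\<And>i. i < n \<Longrightarrow> \<sigma> i = i) \<Longrightarrow> perm_act \<sigma> F = F) \<Longrightarrow> tail_symmetric n F"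
  by (simp add: tail_symmetric_def Sym_fixing_def Sym_N_def)

lemma tail_symmetricD:
  "tail_symmetric n F \<Longrightarrow> bij \<sigma> \<Longrightarrow> (\<And>i. i < n \<Longrightarrow> \<sigma> i = i) \<Longrightarrow> perm_act \<sigma> F = F"
  by (simp add: tail_symmetric_def Sym_fixing_def Sym_N_def)

lemma tail_symmetric_mono:
  assumes "tail_symmetric n F" "n \<le> k"
  shows "tail_symmetric k F"
  using assms(2) by (intro tail_symmetricI tail_symmetricD [OF assms(1)]) simp_all

lemma tail_symmetric_0: "tail_symmetric n 0"
  by (intro tail_symmetricI perm_act_basic)

lemma tail_symmetric_add:
  "tail_symmetric n F \<Longrightarrow> tail_symmetric n G \<Longrightarrow> tail_symmetric n (F + G)"
  by (intro tail_symmetricI) (simp add: perm_act_basic tail_symmetricD)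

lemma tail_symmetric_diff:
  "tail_symmetric n F \<Longrightarrow> tail_symmetric n G \<Longrightarrow> tail_symmetric n (F - G)"
  by (intro tail_symmetricI) (simp add: perm_act_basic tail_symmetricD)

lemma tail_symmetric_mscale: "tail_symmetric n F \<Longrightarrow> tail_symmetric n (mscale c F)"
  by (intro tail_symmetricI) (simp add: perm_act_basic tail_symmetricD)

lemma tail_symmetric_mult:
  "tail_symmetric n F \<Longrightarrow> tail_symmetric n G \<Longrightarrow> tail_symmetric n (F * G)"
  by (intro tail_symmetricI) (simp add: perm_act_mult tail_symmetricD)

lemma tail_symmetric_one: "tail_symmetric n 1"
  by (intro tail_symmetricI perm_act_one)

lemma tail_symmetric_mvar: "i < n \<Longrightarrow> tail_symmetric n (mvar i)"
  by (intro tail_symmetricI) (simp add: perm_act_mvar)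

lemma tail_symmetric_esym: "tail_symmetric n (esym r)"
  by (intro tail_symmetricI perm_act_esym)

section \<open>The ring of eventually symmetric series\<close>

lemma ev_sym_iff: "F \<in> ev_sym \<longleftrightarrow> (\<exists>d. degree_le d F) \<and> (\<exists>n\<ge>1. tail_symmetric n F)"
  by (simp add: ev_sym_def eventually_symmetric_def bounded_degree_iff tail_symmetric_def)

lemma ev_symI: "degree_le d F \<Longrightarrow> tail_symmetric n F \<Longrightarrow> F \<in> ev_sym"
  unfolding ev_sym_iff using tail_symmetric_mono [of n F "Suc n"] by auto

lemma ev_symE2:
  assumes "F \<in> ev_sym" "G \<in> ev_sym"
  obtains d n where "degree_le d F" "degree_le d G" "tail_symmetric n F" "tail_symmetric n G"
proof -
  obtain d n d' n' where "degree_le d F" "tail_symmetric n F" "degree_le d' G" "tail_symmetric n' G"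
    using assms by (auto simp: ev_sym_iff)
  then show ?thesis
    using that [of "max d d'" "max n n'"] by (simp add: degree_le_mono tail_symmetric_mono)
qed

lemma subalgebra_ev_sym: "subalgebra ev_sym"
  unfolding subalgebra_def mfps.subspace_def
proof (intro conjI ballI allI)
  show "0 \<in> ev_sym"
    by (rule ev_symI [OF degree_le_basic(1) tail_symmetric_0])
  show "1 \<in> ev_sym"
    by (rule ev_symI [OF degree_le_basic(2) tail_symmetric_one])
  fix F G :: "(nat, rat) mfps" assume FG: "F \<in> ev_sym" "G \<in> ev_sym"
  then obtain d n where *: "degree_le d F" "degree_le d G" "tail_symmetric n F" "tail_symmetric n G"
    by (rule ev_symE2)
  show "F + G \<in> ev_sym"
    using ev_symI [OF degree_le_add [OF *(1,2)] tail_symmetric_add [OF *(3,4)]] .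
  show "F * G \<in> ev_sym"
    using ev_symI [OF degree_le_mult [OF *(1,2)] tail_symmetric_mult [OF *(3,4)]] .
next
  fix c and F :: "(nat, rat) mfps" assume F: "F \<in> ev_sym"
  obtain d n where *: "degree_le d F" "tail_symmetric n F"
    using ev_symE2 [OF F F] .
  show "mscale c F \<in> ev_sym"
    using ev_symI [OF degree_le_mscale [OF *(1)] tail_symmetric_mscale [OF *(2)]] .
qed

section \<open>Infinite and finitary permutations\<close>

lemma bij_agrees_with_Sym_inf:
  fixes \<sigma> :: "nat \<Rightarrow> nat"
  assumes "inj \<sigma>"
  obtains \<tau> where "\<tau> \<in> Sym_inf" "\<And>i. i < n \<Longrightarrow> \<tau> i = \<sigma> i"
proof -
  (* N bounds n and all values of sigma below n; being a successor it is at least 1, as the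
     definition of Sym_inf requires. *)
  define N where "N = Suc (n + (\<Sum>i<n. \<sigma> i))"
  have N: "n \<le> N" "\<sigma> ` {..<n} \<subseteq> {..<N}"
    using member_le_sum [of _ "{..<n}" \<sigma>] by (auto simp: N_def less_Suc_eq_le trans_le_add2)
  have bij1: "bij_betw \<sigma> {..<n} (\<sigma> ` {..<n})"
    using inj_on_subset [OF assms subset_UNIV] by (rule inj_on_imp_bij_betw)
  have "card ({..<N} - {..<n}) = card ({..<N} - \<sigma> ` {..<n})"
    using N bij_betw_same_card [OF bij1] by (simp add: card_Diff_subset)
  then obtain g where g: "bij_betw g ({..<N} - {..<n}) ({..<N} - \<sigma> ` {..<n})"
    using finite_same_card_bij by blast
  define \<tau> where "\<tau> = (\<lambda>k. if k < n then \<sigma> k else if k < N then g k else k)"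
  have "bij_betw \<tau> ({..<n} \<union> ({..<N} - {..<n})) (\<sigma> ` {..<n} \<union> ({..<N} - \<sigma> ` {..<n}))"
  proof (rule bij_betw_combine)
    show "bij_betw \<tau> {..<n} (\<sigma> ` {..<n})"
      using bij1 by (rule bij_betw_cong [THEN iffD1, rotated]) (simp add: \<tau>_def)
    show "bij_betw \<tau> ({..<N} - {..<n}) ({..<N} - \<sigma> ` {..<n})"
      using g by (rule bij_betw_cong [THEN iffD1, rotated]) (simp add: \<tau>_def)
  qed auto
  moreover have "{..<n} \<union> ({..<N} - {..<n}) = {..<N}" "\<sigma> ` {..<n} \<union> ({..<N} - \<sigma> ` {..<n}) = {..<N}"
    using N by auto
  ultimately have "\<tau> permutes {..<N}"
    using N by (intro bij_imp_permutes) (auto simp: \<tau>_def)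
  then have "\<tau> \<in> Sym_inf"
    by (auto simp: Sym_inf_def Sym_upto_def N_def intro!: bexI [of _ N])
  then show ?thesis
    using that by (simp add: \<tau>_def)
qed

lemma perm_act_eq_if_agree:
  assumes F: "tail_symmetric n F" and "bij \<sigma>" "bij \<tau>" and agree: "\<And>i. i < n \<Longrightarrow> \<tau> i = \<sigma> i"
  shows "perm_act \<sigma> F = perm_act \<tau> F"
proof -
  have "bij (inv \<tau> \<circ> \<sigma>)"
    using assms by (simp add: bij_comp bij_imp_bij_inv)
  moreover have "(inv \<tau> \<circ> \<sigma>) i = i" if "i < n" for i
    using agree [OF that] \<open>bij \<tau>\<close> by (metis bij_is_inj comp_apply inv_f_f)
  ultimately have "perm_act (inv \<tau> \<circ> \<sigma>) F = F"
    using F by (simp add: tail_symmetric_def Sym_fixing_def Sym_N_def)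
  moreover have "\<sigma> = \<tau> \<circ> (inv \<tau> \<circ> \<sigma>)"
    using \<open>bij \<tau>\<close> by (simp add: fun_eq_iff bij_is_surj surj_f_inv_f)
  ultimately show ?thesis
    using perm_act_compose [of \<tau> "inv \<tau> \<circ> \<sigma>" F] \<open>bij \<tau>\<close> \<open>bij (inv \<tau> \<circ> \<sigma>)\<close>
    by (simp add: bij_is_inj)
qed

lemma Sym_inf_subset: "Sym_inf \<subseteq> Sym_N"
  by (auto simp: Sym_inf_def Sym_upto_def Sym_N_def permutes_bij)

lemma invariant_under_Sym_N_iff:
  assumes "V \<subseteq> ev_sym"
  shows "invariant_under Sym_inf V \<longleftrightarrow> invariant_under Sym_N V"
proof
  assume inv: "invariant_under Sym_inf V"
  show "invariant_under Sym_N V"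
    unfolding invariant_under_def
  proof (intro ballI)
    fix \<sigma> F assume \<sigma>: "\<sigma> \<in> Sym_N" and F: "F \<in> V"
    obtain n where n: "tail_symmetric n F"
      using F assms unfolding ev_sym_iff subset_iff by meson
    obtain \<tau> where \<tau>: "\<tau> \<in> Sym_inf" "\<And>i. i < n \<Longrightarrow> \<tau> i = \<sigma> i"
      using bij_agrees_with_Sym_inf [of \<sigma> n] \<sigma> by (auto simp: Sym_N_def bij_is_inj)
    have "perm_act \<sigma> F = perm_act \<tau> F"
      using n \<sigma> \<tau> Sym_inf_subset by (intro perm_act_eq_if_agree) (auto simp: Sym_N_def)
    then show "perm_act \<sigma> F \<in> V"
      using inv F \<tau>(1) by (simp add: invariant_under_def)
  qed
qed (use Sym_inf_subset in \<open>auto simp: invariant_under_def\<close>)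

lemma tail_symmetric_perm_act:
  assumes F: "tail_symmetric n F" and "bij \<sigma>" and k: "\<And>i. i < n \<Longrightarrow> \<sigma> i < k"
  shows "tail_symmetric k (perm_act \<sigma> F)"
  unfolding tail_symmetric_def
proof
  fix \<tau> assume \<tau>: "\<tau> \<in> Sym_fixing k"
  then have "bij \<tau>"
    by (rule bij_Sym_fixing)
  have "perm_act \<tau> (perm_act \<sigma> F) = perm_act (\<tau> \<circ> \<sigma>) F"
    using \<open>bij \<tau>\<close> \<open>bij \<sigma>\<close> by (simp add: perm_act_compose bij_is_inj)
  also have "\<dots> = perm_act \<sigma> F"
    using \<tau> \<open>bij \<tau>\<close> \<open>bij \<sigma>\<close> k
    by (intro perm_act_eq_if_agree [OF F]) (auto simp: bij_comp Sym_fixing_def)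
  finally show "perm_act \<tau> (perm_act \<sigma> F) = perm_act \<sigma> F" .
qed

lemma invariant_under_Sym_N_ev_sym: "invariant_under Sym_N ev_sym"
  unfolding invariant_under_def
proof (intro ballI)
  fix \<sigma> and F :: "(nat, rat) mfps"
  assume "\<sigma> \<in> Sym_N" and F: "F \<in> ev_sym"
  then have \<sigma>: "bij \<sigma>"
    by (simp add: Sym_N_def)
  obtain d n where dn: "degree_le d F" "tail_symmetric n F"
    using F by (auto simp: ev_sym_iff)
  obtain k where "\<And>i. i < n \<Longrightarrow> \<sigma> i < k"
    using finite_nat_set_iff_bounded [of "\<sigma> ` {..<n}"] by auto
  then show "perm_act \<sigma> F \<in> ev_sym"
    using ev_symI [OF degree_le_perm_act [OF \<sigma> dn(1)] tail_symmetric_perm_act [OF dn(2) \<sigma>]]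
    by blast
qed

section \<open>Leading monomials\<close>

text \<open>
  The exponents of \<open>m\<close> at the variables of index at least \<open>n\<close>, re-indexed to start at \<open>0\<close>. Tails
  are compared by the order of finitely supported functions, which is decided at the least
  index where they differ: \<open>f < g\<close> if \<open>f\<close> is smaller than \<open>g\<close> there.
\<close>

definition tail :: "nat \<Rightarrow> (nat \<Rightarrow>\<^sub>0 nat) \<Rightarrow> (nat \<Rightarrow>\<^sub>0 nat)" where
  "tail n m = Poly_Mapping.map_key ((+) n) m"

lemma lookup_tail [simp]: "Poly_Mapping.lookup (tail n m) j = Poly_Mapping.lookup m (n + j)"
  by (simp add: tail_def)

lemma tail_add: "tail n (a + b) = tail n a + tail n b"
  by (intro poly_mapping_eqI) (simp add: lookup_add)

text \<open>
  The monomial \<open>m\<close> has coefficient 1 in \<open>F\<close>, and every other monomial of \<open>F\<close> has a strictly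
  smaller tail. Comparing tails only gives a preorder on monomials, so strictness is a genuine
  requirement: no other monomial of \<open>F\<close> may share the tail of \<open>m\<close>.
\<close>

definition leading :: "nat \<Rightarrow> (nat \<Rightarrow>\<^sub>0 nat) \<Rightarrow> (nat, 'a::comm_ring_1) mfps \<Rightarrow> bool" where
  "leading n m F \<longleftrightarrow> mcoeff F m = 1 \<and> (\<forall>m'. mcoeff F m' \<noteq> 0 \<longrightarrow> m' \<noteq> m \<longrightarrow> tail n m' < tail n m)"

lemma leading_coeff: "leading n m F \<Longrightarrow> mcoeff F m = 1"
  by (simp add: leading_def)

lemma leading_less: "leading n m F \<Longrightarrow> mcoeff F m' \<noteq> 0 \<Longrightarrow> m' \<noteq> m \<Longrightarrow> tail n m' < tail n m"
  by (simp add: leading_def)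

lemma leading_one: "leading n 0 1"
  by (simp add: leading_def)

lemma leading_mvar: "leading n (Poly_Mapping.single i 1) (mvar i)"
  by (simp add: leading_def)

lemma leading_mult:
  assumes F: "leading n a F" and G: "leading n b G"
  shows "leading n (a + b) (F * G)"
proof -
  have strict: "tail n (a' + b') < tail n (a + b)"
    if "mcoeff F a' \<noteq> 0" "mcoeff G b' \<noteq> 0" "(a', b') \<noteq> (a, b)" for a' b'
  proof (cases "a' = a")
    case True
    then have "tail n b' < tail n b"
      using leading_less [OF G that(2)] that(3) by simp
    then show ?thesis
      by (simp add: tail_add True)
  next
    case False
    then have "tail n a' < tail n a"
      by (rule leading_less [OF F that(1)])
    moreover have "tail n b' \<le> tail n b"
      using leading_less [OF G that(2)] by (cases "b' = b") (simp_all add: less_imp_le)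
    ultimately show ?thesis
      unfolding tail_add by (rule add_less_le_mono)
  qed
  have "(\<Sum>(a', b') | a' + b' = a + b. mcoeff F a' * mcoeff G b') =
      (\<Sum>(a', b')\<in>{(a, b)}. mcoeff F a' * mcoeff G b')"
  proof (rule sum.mono_neutral_right)
    show "\<forall>p\<in>{(a', b'). a' + b' = a + b} - {(a, b)}. (case p of (a', b') \<Rightarrow> mcoeff F a' * mcoeff G b') = 0"
    proof
      fix p assume p: "p \<in> {(a', b'). a' + b' = a + b} - {(a, b)}"
      obtain a' b' where ab: "p = (a', b')"
        by (cases p) blast
      then have "\<not> tail n (a' + b') < tail n (a + b)"
        using p by simp
      then have "mcoeff F a' = 0 \<or> mcoeff G b' = 0"
        using strict [of a' b'] p ab by blast
      then show "(case p of (a', b') \<Rightarrow> mcoeff F a' * mcoeff G b') = 0"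
        by (auto simp: ab)
    qed
  qed (use finite_monomial_splittings in auto)
  then have "mcoeff (F * G) (a + b) = 1"
    using F G by (simp add: mcoeff_mult leading_coeff)
  moreover have "tail n m < tail n (a + b)" if m: "mcoeff (F * G) m \<noteq> 0" "m \<noteq> a + b" for m
  proof -
    obtain a' b' where *: "a' + b' = m" "mcoeff F a' \<noteq> 0" "mcoeff G b' \<noteq> 0"
      using m(1) by (rule mcoeff_mult_nonzeroE)
    then have "(a', b') \<noteq> (a, b)"
      using m(2) by auto
    then show ?thesis
      using strict [OF *(2,3)] *(1) by simp
  qed
  ultimately show ?thesis
    by (simp add: leading_def)
qed

lemma leading_prod:
  assumes "finite A" "\<And>i. i \<in> A \<Longrightarrow> leading n (m i) (F i)"
  shows "leading n (\<Sum>i\<in>A. m i) (\<Prod>i\<in>A. F i)"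
  using assms by (induction A) (simp_all add: leading_one leading_mult)

lemma leading_power: "leading n m F \<Longrightarrow> leading n (\<Sum>j<k. m) (F ^ k)"
  using leading_prod [of "{..<k}" n "\<lambda>_. m" "\<lambda>_. F"] by simp

text \<open>
  The monomial \<open>x\<^sub>n x\<^sub>n\<^sub>+\<^sub>1 \<cdots> x\<^sub>n\<^sub>+\<^sub>r\<^sub>-\<^sub>1\<close>. When the tail exponents of a monomial form a
  partition, these are the columns of its Young diagram.
\<close>

definition column :: "nat \<Rightarrow> nat \<Rightarrow> (nat \<Rightarrow>\<^sub>0 nat)" where
  "column n r = (\<Sum>i\<in>{n..<n + r}. Poly_Mapping.single i 1)"

lemma lookup_column: "Poly_Mapping.lookup (column n r) i = of_bool (n \<le> i \<and> i < n + r)"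
  unfolding column_def by (subst lookup_sum_single) simp_all

lemma mon_degree_column: "mon_degree (column n r) = r"
  by (simp add: column_def mon_degree_sum)

text \<open>
  A squarefree monomial of degree \<open>r\<close> other than the column misses some factor of the column;
  at the first missing one its tail drops below that of the column.
\<close>

lemma leading_esym: "leading n (column n r) (esym r)"
  unfolding leading_def
proof (intro conjI allI impI)
  show "mcoeff (esym r) (column n r) = 1"
    unfolding column_def by (rule mcoeff_esym_squarefree) simp_all
  fix m' assume "mcoeff (esym r) m' \<noteq> 0" and neq: "m' \<noteq> column n r"
  then obtain A where A: "finite A" "card A = r" "m' = (\<Sum>i\<in>A. Poly_Mapping.single i 1)"
    using esym_nonzeroE by blast
  have "A \<noteq> {n..<n + r}"
    using neq A(3) by (auto simp: column_def)
  then have "\<not> {n..<n + r} \<subseteq> A"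
    using card_subset_eq [OF A(1), of "{n..<n + r}"] A(2) by auto
  then obtain i where i: "n \<le> i" "i < n + r" "i \<notin> A"
    by (meson atLeastLessThan_iff subsetI)
  define k where "k = (LEAST j. n + j \<notin> A)"
  have "n + k \<notin> A"
    unfolding k_def by (rule LeastI [of _ "i - n"]) (use i in simp)
  have "k \<le> i - n"
    unfolding k_def by (rule Least_le) (use i in simp)
  then have "k < r"
    using i by linarith
  have below: "n + j \<in> A" if "j < k" for j
    using not_less_Least [of j "\<lambda>j. n + j \<notin> A"] that by (simp add: k_def)
  show "tail n m' < tail n (column n r)"
    unfolding less_poly_mapping.rep_eq less_fun_def
    using \<open>n + k \<notin> A\<close> \<open>k < r\<close> below
    by (intro exI [of _ k]) (simp add: lookup_column A(3) lookup_sum_single [OF A(1)] del: One_nat_def)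
qed

section \<open>Algebraic independence\<close>

text \<open>
  The leading monomials of the generators, where \<open>Inl i\<close> stands for \<open>x\<^sub>i\<close> and \<open>Inr r\<close> for \<open>e\<^sub>r\<close>.
\<close>

definition generator_monomial :: "nat \<Rightarrow> nat + nat \<Rightarrow> (nat \<Rightarrow>\<^sub>0 nat)" where
  "generator_monomial n = case_sum (\<lambda>i. Poly_Mapping.single i 1) (column n)"

text \<open>
  The leading monomial of the product of generators with exponents \<open>M\<close>. The inner sum of a
  constant is its multiple by \<open>Poly_Mapping.lookup M k\<close>.
\<close>

definition leading_monomial :: "nat \<Rightarrow> (nat + nat \<Rightarrow>\<^sub>0 nat) \<Rightarrow> (nat \<Rightarrow>\<^sub>0 nat)" where
  "leading_monomial n M =
     (\<Sum>k\<in>Poly_Mapping.keys M. \<Sum>j<Poly_Mapping.lookup M k. generator_monomial n k)"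

lemma leading_monomial_of_product:
  "leading n (leading_monomial n M)
     (\<Prod>k\<in>Poly_Mapping.keys M. case_sum mvar esym k ^ Poly_Mapping.lookup M k)"
  unfolding leading_monomial_def
proof (intro leading_prod leading_power)
  fix k show "leading n (generator_monomial n k) (case_sum mvar esym k)"
    unfolding generator_monomial_def
    by (cases k) (simp_all only: sum.case leading_mvar leading_esym)
qed simp

lemma lookup_leading_monomial:
  "Poly_Mapping.lookup (leading_monomial n M) i =
     (\<Sum>k\<in>Poly_Mapping.keys M. Poly_Mapping.lookup M k * Poly_Mapping.lookup (generator_monomial n k) i)"
  unfolding leading_monomial_def lookup_sum by simp

lemma sum_lookup_eq_key:
  "(\<Sum>k\<in>Poly_Mapping.keys M. Poly_Mapping.lookup M k * of_bool (k = x)) = Poly_Mapping.lookup M x"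
  for M :: "'i \<Rightarrow>\<^sub>0 nat"
proof -
  have "(\<Sum>k\<in>Poly_Mapping.keys M. Poly_Mapping.lookup M k * of_bool (k = x)) =
      (\<Sum>k\<in>Poly_Mapping.keys M. if k = x then Poly_Mapping.lookup M x else 0)"
    by (intro sum.cong) auto
  also have "\<dots> = Poly_Mapping.lookup M x"
    by (simp add: sum.delta in_keys_iff)
  finally show ?thesis .
qed

lemma lookup_leading_monomial_Inl:
  assumes "i < n"
  shows "Poly_Mapping.lookup (leading_monomial n M) i = Poly_Mapping.lookup M (Inl i)"
proof -
  have "Poly_Mapping.lookup (generator_monomial n k) i = of_bool (k = Inl i)" for k
    using assms by (cases k) (auto simp: generator_monomial_def lookup_column lookup_single when_def)
  then show ?thesis
    by (simp only: lookup_leading_monomial sum_lookup_eq_key)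
qed

text \<open>
  Among the columns, exactly the one of height \<open>Suc j\<close> contains \<open>n + j\<close> but not \<open>n + Suc j\<close>. Hence
  consecutive tail exponents differ by the exponent of one elementary symmetric series.
\<close>

lemma lookup_leading_monomial_Inr:
  assumes "\<And>i. Inl i \<in> Poly_Mapping.keys M \<Longrightarrow> i < n"
  shows "Poly_Mapping.lookup (leading_monomial n M) (n + j) =
      Poly_Mapping.lookup (leading_monomial n M) (n + Suc j) + Poly_Mapping.lookup M (Inr (Suc j))"
proof -
  have "Poly_Mapping.lookup (generator_monomial n k) (n + j) =
      Poly_Mapping.lookup (generator_monomial n k) (n + Suc j) + of_bool (k = Inr (Suc j))"
    if "k \<in> Poly_Mapping.keys M" for k
  proof (cases k)
    case (Inl i)
    then have "i < n"
      using that assms by simp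
    then show ?thesis
      by (simp add: Inl generator_monomial_def lookup_single when_def)
  next
    case (Inr r)
    then show ?thesis
      by (auto simp: generator_monomial_def lookup_column)
  qed
  then have "Poly_Mapping.lookup (leading_monomial n M) (n + j) = (\<Sum>k\<in>Poly_Mapping.keys M.
      Poly_Mapping.lookup M k * Poly_Mapping.lookup (generator_monomial n k) (n + Suc j) +
      Poly_Mapping.lookup M k * of_bool (k = Inr (Suc j)))"
    unfolding lookup_leading_monomial by (intro sum.cong) (simp_all only: distrib_left)
  then show ?thesis
    by (simp only: sum.distrib sum_lookup_eq_key lookup_leading_monomial)
qed

lemma leading_monomial_inject:
  assumes M: "Poly_Mapping.keys M \<subseteq> {..<n} <+> {1..}" and M': "Poly_Mapping.keys M' \<subseteq> {..<n} <+> {1..}"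
    and eq: "leading_monomial n M = leading_monomial n M'"
  shows "M = M'"
proof (rule poly_mapping_eqI)
  have less: "i < n" if "Inl i \<in> Poly_Mapping.keys M \<or> Inl i \<in> Poly_Mapping.keys M'" for i
    using M M' that by auto
  fix k
  show "Poly_Mapping.lookup M k = Poly_Mapping.lookup M' k"
  proof (cases k)
    case (Inl i)
    show ?thesis
    proof (cases "i < n")
      case True
      then show ?thesis
        using lookup_leading_monomial_Inl [OF True, of M] lookup_leading_monomial_Inl [OF True, of M']
          by (simp add: Inl eq)
    next
      case False
      then have "k \<notin> Poly_Mapping.keys M" "k \<notin> Poly_Mapping.keys M'"
        using less Inl by auto
      then show ?thesis
        by (simp add: in_keys_iff)
    qed
  next
    case (Inr r)
    show ?thesis
    proof (cases r)
      case 0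
      then have "k \<notin> Poly_Mapping.keys M" "k \<notin> Poly_Mapping.keys M'"
        using M M' Inr by auto
      then show ?thesis
        by (simp add: in_keys_iff)
    next
      case (Suc j)
      then show ?thesis
        using lookup_leading_monomial_Inr [of M n j] lookup_leading_monomial_Inr [of M' n j] less
        by (simp add: Inr eq)
    qed
  qed
qed

lemma algebraically_independent_mvar_esym:
  "algebraically_independent (UNIV <+> {1..})
     (case_sum mvar esym :: nat + nat \<Rightarrow> (nat, 'a::comm_ring_1) mfps)"
  unfolding algebraically_independent_def
proof (intro allI impI, rule ccontr)
  fix p :: "(nat + nat \<Rightarrow>\<^sub>0 nat) \<Rightarrow>\<^sub>0 'a"
  assume keys: "\<forall>M\<in>Poly_Mapping.keys p. Poly_Mapping.keys M \<subseteq> UNIV <+> {1..}"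
    and zero: "poly_subst (case_sum mvar esym) p = 0" and "p \<noteq> 0"
  (* n exceeds every index i for which x_i occurs in p *)
  have "finite (Inl -` (\<Union>M\<in>Poly_Mapping.keys p. Poly_Mapping.keys M))"
    by (intro finite_vimageI) auto
  then obtain n where n: "\<forall>i\<in>Inl -` (\<Union>M\<in>Poly_Mapping.keys p. Poly_Mapping.keys M). i < n"
    using finite_nat_set_iff_bounded by blast
  have sub: "Poly_Mapping.keys M \<subseteq> {..<n} <+> {1..}" if "M \<in> Poly_Mapping.keys p" for M
  proof
    fix k assume "k \<in> Poly_Mapping.keys M"
    then show "k \<in> {..<n} <+> {1..}"
      using n keys that by (cases k) auto
  qed
  let ?T = "\<lambda>M. tail n (leading_monomial n M)"
  let ?B = "\<lambda>M. \<Prod>k\<in>Poly_Mapping.keys M. case_sum mvar esym k ^ Poly_Mapping.lookup M k :: (nat, 'a) mfps"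
  have "Max (?T ` Poly_Mapping.keys p) \<in> ?T ` Poly_Mapping.keys p"
    using \<open>p \<noteq> 0\<close> by (intro Max_in) auto
  then obtain M where M: "M \<in> Poly_Mapping.keys p" "?T M = Max (?T ` Poly_Mapping.keys p)"
    by auto
  have other: "mcoeff (?B M') (leading_monomial n M) = 0" if "M' \<in> Poly_Mapping.keys p" "M' \<noteq> M" for M'
  proof (rule ccontr)
    assume "mcoeff (?B M') (leading_monomial n M) \<noteq> 0"
    moreover have "leading_monomial n M \<noteq> leading_monomial n M'"
      using leading_monomial_inject [OF sub [OF M(1)] sub [OF that(1)]] that(2) by auto
    ultimately have "?T M < ?T M'"
      using leading_less [OF leading_monomial_of_product] by blast
    moreover have "?T M' \<le> ?T M"
      unfolding M(2) using that(1) by (intro Max_ge) auto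
    ultimately show False
      by simp
  qed
  have "mcoeff (poly_subst (case_sum mvar esym) p) (leading_monomial n M) =
      (\<Sum>M'\<in>Poly_Mapping.keys p. Poly_Mapping.lookup p M' * mcoeff (?B M') (leading_monomial n M))"
    by (simp add: poly_subst_def mcoeff_sum)
  also have "\<dots> = (\<Sum>M'\<in>{M}. Poly_Mapping.lookup p M' * mcoeff (?B M') (leading_monomial n M))"
    using M(1) other by (intro sum.mono_neutral_right) auto
  also have "\<dots> = Poly_Mapping.lookup p M"
    using leading_coeff [OF leading_monomial_of_product [of n M, where 'a = 'a]] by simp
  finally have "Poly_Mapping.lookup p M = 0"
    by (simp add: zero)
  with M(1) show False
    by (simp add: in_keys_iff)
qed

section \<open>Generation by variables and elementary symmetric series\<close>

text \<open>The exponents of \<open>x\<^sub>n, x\<^sub>n\<^sub>+\<^sub>1, \<dots>\<close> in \<open>m\<close> decrease weakly; those below \<open>n\<close> are arbitrary.\<close>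

definition dominant :: "nat \<Rightarrow> (nat \<Rightarrow>\<^sub>0 nat) \<Rightarrow> bool" where
  "dominant n m \<longleftrightarrow> antimono (Poly_Mapping.lookup (tail n m))"

lemma dominantD:
  "dominant n m \<Longrightarrow> i \<le> j \<Longrightarrow> Poly_Mapping.lookup m (n + j) \<le> Poly_Mapping.lookup m (n + i)"
  unfolding dominant_def by (drule antimonoD) simp_all

lemma dominantI:
  "(\<And>i j. i \<le> j \<Longrightarrow> Poly_Mapping.lookup m (n + j) \<le> Poly_Mapping.lookup m (n + i)) \<Longrightarrow> dominant n m"
  unfolding dominant_def by (rule antimonoI) simp

lemma lookup_eventually_0:
  fixes m :: "nat \<Rightarrow>\<^sub>0 'a::zero"
  shows "\<exists>L. \<forall>i\<ge>L. Poly_Mapping.lookup m i = 0"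
proof -
  obtain L where "\<forall>i\<in>Poly_Mapping.keys m. i < L"
    using finite_nat_set_iff_bounded [of "Poly_Mapping.keys m"] by auto
  then have "Poly_Mapping.lookup m i = 0" if "L \<le> i" for i
    using that not_less in_keys_iff [of i m] by blast
  then show ?thesis
    by blast
qed

lemma ex_dominant_rearrangement:
  fixes m :: "nat \<Rightarrow>\<^sub>0 nat"
  obtains \<sigma> where "bij \<sigma>" "\<And>i. i < n \<Longrightarrow> \<sigma> i = i" "dominant n (Poly_Mapping.map_key \<sigma> m)"
proof -
  obtain L where L: "\<forall>i\<ge>L. Poly_Mapping.lookup m i = 0"
    using lookup_eventually_0 [of m] by blast
  (* the permutation is obtained from one that sorts the list of exponents of x_n, ..., x_(n+L-1) *)
  define xs where "xs = map (\<lambda>j. Poly_Mapping.lookup m (n + j)) [0..<L]"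
  define ys where "ys = rev (sort xs)"
  have len: "length xs = L" "length ys = L"
    by (simp_all add: xs_def ys_def)
  have "mset ys = mset xs"
    by (simp add: ys_def)
  then obtain p where p: "p permutes {..<length xs}" "permute_list p xs = ys"
    by (rule mset_eq_permutation)
  define \<sigma> where "\<sigma> = (\<lambda>k. if k < n then k else n + p (k - n))"
  have "bij \<sigma>"
  proof (rule o_bij)
    define \<tau> where "\<tau> = (\<lambda>k. if k < n then k else n + inv p (k - n))"
    show "\<tau> \<circ> \<sigma> = id" "\<sigma> \<circ> \<tau> = id"
      by (auto simp: \<sigma>_def \<tau>_def fun_eq_iff permutes_inverses [OF p(1)])
  qed
  have ys_nth: "ys ! j = Poly_Mapping.lookup m (n + p j)" if "j < L" for j
  proof -
    have "p j < L"
      using permutes_in_image [OF p(1), of j] that len by simp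
    then show ?thesis
      using permute_list_nth [OF p(1), of j] that len p(2) by (simp add: xs_def)
  qed
  have lookup: "Poly_Mapping.lookup (Poly_Mapping.map_key \<sigma> m) (n + j) = Poly_Mapping.lookup m (n + p j)" for j
    using \<open>bij \<sigma>\<close> by (simp add: bij_is_inj \<sigma>_def)
  have "dominant n (Poly_Mapping.map_key \<sigma> m)"
  proof (rule dominantI)
    fix i j :: nat assume "i \<le> j"
    show "Poly_Mapping.lookup (Poly_Mapping.map_key \<sigma> m) (n + j)
        \<le> Poly_Mapping.lookup (Poly_Mapping.map_key \<sigma> m) (n + i)"
    proof (cases "j < L")
      case True
      have "ys ! j \<le> ys ! i"
        unfolding ys_def using True \<open>i \<le> j\<close> len
        by (auto simp: rev_nth intro!: sorted_nth_mono)
      then show ?thesis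
        using True \<open>i \<le> j\<close> by (simp add: lookup ys_nth)
    next
      case False
      then have "p j = j"
        using permutes_not_in [OF p(1), of j] len by simp
      then show ?thesis
        using False L by (simp add: lookup)
    qed
  qed
  then show ?thesis
    using that [of \<sigma>] \<open>bij \<sigma>\<close> by (simp add: \<sigma>_def)
qed

lemma lookup_le_mon_degree: "Poly_Mapping.lookup m i \<le> mon_degree m"
  unfolding mon_degree_def
  by (cases "i \<in> Poly_Mapping.keys m") (auto simp: in_keys_iff intro: member_le_sum)

text \<open>
  If the variable of index \<open>i \<ge> n\<close> occurs in a dominant monomial, then so do all those with
  index from \<open>n\<close> to \<open>i\<close>, so a bound on the degree bounds \<open>i\<close> too.
\<close>

lemma finite_dominant: "finite {m. dominant n m \<and> mon_degree m \<le> d}"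
proof -
  let ?S = "{f. \<forall>i. (i \<in> {..<n + d} \<longrightarrow> f i \<in> {..d}) \<and> (i \<notin> {..<n + d} \<longrightarrow> f i = 0)}"
  have bounds: "Poly_Mapping.lookup m \<in> ?S" if m: "dominant n m" "mon_degree m \<le> d" for m
  proof -
    have "Poly_Mapping.lookup m i = 0" if i: "n + d \<le> i" for i
    proof (rule ccontr)
      assume nz: "Poly_Mapping.lookup m i \<noteq> 0"
      have pos: "1 \<le> Poly_Mapping.lookup m k" if "k \<in> {n..i}" for k
      proof -
        have "Poly_Mapping.lookup m i \<le> Poly_Mapping.lookup m k"
          using dominantD [OF m(1), of "k - n" "i - n"] that by (simp add: diff_le_mono)
        then show ?thesis
          using nz by simp
      qed
      have sub: "{n..i} \<subseteq> Poly_Mapping.keys m"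
      proof
        fix k assume "k \<in> {n..i}"
        then show "k \<in> Poly_Mapping.keys m"
          using pos [of k] by (simp add: in_keys_iff)
      qed
      have "d < card {n..i}"
        using i by simp
      also have "card {n..i} \<le> (\<Sum>k\<in>{n..i}. Poly_Mapping.lookup m k)"
        using sum_mono [OF pos, of "{n..i}"] by simp
      also have "\<dots> \<le> mon_degree m"
        unfolding mon_degree_def by (rule sum_mono2 [OF finite_keys sub]) simp
      finally show False
        using m(2) by simp
    qed
    then show ?thesis
      using le_trans [OF lookup_le_mon_degree m(2)] by simp
  qed
  have "Poly_Mapping.lookup ` {m. dominant n m \<and> mon_degree m \<le> d} \<subseteq> ?S"
  proof (rule image_subsetI)
    fix m assume "m \<in> {m. dominant n m \<and> mon_degree m \<le> d}"
    then have "dominant n m" "mon_degree m \<le> d"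
      by simp_all
    then show "Poly_Mapping.lookup m \<in> ?S"
      by (rule bounds)
  qed
  moreover have "finite ?S"
    by (rule finite_set_of_finite_funs) simp_all
  ultimately show ?thesis
    by (rule finite_imageD [OF finite_subset]) (simp add: inj_on_def)
qed

lemma tail_symmetric_eq_0:
  assumes F: "tail_symmetric n F" "degree_le d F"
    and zero: "\<And>m. dominant n m \<Longrightarrow> mon_degree m \<le> d \<Longrightarrow> mcoeff F m = 0"
  shows "F = 0"
proof (rule mfps_eqI)
  fix m
  obtain \<sigma> where \<sigma>: "bij \<sigma>" "\<And>i. i < n \<Longrightarrow> \<sigma> i = i" "dominant n (Poly_Mapping.map_key \<sigma> m)"
    using ex_dominant_rearrangement [of n m] by blast
  have "mcoeff F (Poly_Mapping.map_key \<sigma> m) = 0"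
    using zero [OF \<sigma>(3)] F(2) by (auto simp: degree_le_def)
  then have "mcoeff (perm_act \<sigma> F) m = 0"
    by simp
  then show "mcoeff F m = mcoeff 0 m"
    using tail_symmetricD [OF F(1) \<sigma>(1,2)] by simp
qed

lemma subalgebraD:
  assumes "subalgebra H"
  shows "0 \<in> H" "1 \<in> H" "F \<in> H \<Longrightarrow> G \<in> H \<Longrightarrow> F + G \<in> H"
    "F \<in> H \<Longrightarrow> G \<in> H \<Longrightarrow> F * G \<in> H" "F \<in> H \<Longrightarrow> mscale c F \<in> H"
  using assms by (simp_all add: subalgebra_def mfps.subspace_def)

text \<open>
  Built by splitting off one generator at a time: a variable of index below \<open>n\<close> if one occurs
  in \<open>m\<close>, and otherwise the first column of the partition formed by the tail exponents.
\<close>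

lemma ex_leading_at_dominant:
  fixes H :: "(nat, 'a::field) mfps set"
  assumes H: "subalgebra H" "range mvar \<subseteq> H" "esym ` {1..} \<subseteq> H" and "dominant n m"
  shows "\<exists>B\<in>H. tail_symmetric n B \<and> degree_le (mon_degree m) B \<and> leading n m B"
  using \<open>dominant n m\<close>
proof (induction "mon_degree m" arbitrary: m rule: less_induct)
  case less
  have step: ?case if m: "m = m' + g" and g: "mon_degree g > 0" and "dominant n m'"
    and G: "G \<in> H" "tail_symmetric n G" "degree_le (mon_degree g) G" "leading n g G" for m' g G
  proof -
    have "mon_degree m' < mon_degree m"
      using g by (simp add: m mon_degree_add)
    from less.hyps [OF this \<open>dominant n m'\<close>]
    obtain B where B: "B \<in> H" "tail_symmetric n B" "degree_le (mon_degree m') B" "leading n m' B"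
      by (elim bexE conjE)
    show ?thesis
    proof (intro bexI conjI)
      show "tail_symmetric n (B * G)"
        by (rule tail_symmetric_mult [OF B(2) G(2)])
      show "degree_le (mon_degree m) (B * G)"
        unfolding m mon_degree_add by (rule degree_le_mult [OF B(3) G(3)])
      show "leading n m (B * G)"
        unfolding m by (rule leading_mult [OF B(4) G(4)])
      show "B * G \<in> H"
        by (rule subalgebraD(4) [OF H(1) B(1) G(1)])
    qed
  qed
  show ?case
  proof (cases "\<exists>i<n. Poly_Mapping.lookup m i \<noteq> 0")
    case True
    then obtain i where i: "i < n" "Poly_Mapping.lookup m i \<noteq> 0"
      by blast
    show ?thesis
    proof (rule step [of "m - Poly_Mapping.single i 1" "Poly_Mapping.single i 1" "mvar i"])
      show "m = m - Poly_Mapping.single i 1 + Poly_Mapping.single i 1"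
        using i(2) by (intro poly_mapping_eqI) (auto simp: lookup_add lookup_minus lookup_single when_def)
      show "dominant n (m - Poly_Mapping.single i 1)"
        using i(1) dominantD [OF less.prems]
        by (intro dominantI) (simp add: lookup_minus lookup_single when_def)
      show "mvar i \<in> H"
        using H(2) by (rule subsetD) simp
      show "tail_symmetric n (mvar i)"
        using i(1) by (rule tail_symmetric_mvar)
      show "leading n (Poly_Mapping.single i 1) (mvar i)"
        by (rule leading_mvar)
    qed (use degree_le_basic(3) in simp_all)
  next
    case low: False
    show ?thesis
    proof (cases "Poly_Mapping.lookup m n = 0")
      case True
      have "Poly_Mapping.lookup m i = 0" for i
      proof (cases "i < n")
        case True
        then show ?thesis
          using low by blast
      next
        case False
        then show ?thesis
          using dominantD [OF less.prems, of 0 "i - n"] \<open>Poly_Mapping.lookup m n = 0\<close> by simp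
      qed
      then have "m = 0"
        by (intro poly_mapping_eqI) simp
      show ?thesis
        unfolding \<open>m = 0\<close>
        by (intro bexI [of _ 1] conjI tail_symmetric_one leading_one degree_le_basic(2)
            subalgebraD(2) [OF H(1)])
    next
      case False
      (* the height of the first column, i.e. the number of nonzero tail exponents *)
      define r where "r = (LEAST j. Poly_Mapping.lookup m (n + j) = 0)"
      obtain L where "\<forall>i\<ge>L. Poly_Mapping.lookup m i = 0"
        using lookup_eventually_0 [of m] by blast
      then have "Poly_Mapping.lookup m (n + L) = 0"
        by simp
      then have r0: "Poly_Mapping.lookup m (n + r) = 0"
        unfolding r_def by (rule LeastI)
      have pos: "Poly_Mapping.lookup m (n + j) \<noteq> 0" if "j < r" for j
        using not_less_Least [of j "\<lambda>j. Poly_Mapping.lookup m (n + j) = 0"] that by (simp add: r_def)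
      have "r \<noteq> 0"
        using r0 False by (cases r) simp_all
      show ?thesis
      proof (rule step [of "m - column n r" "column n r" "esym r"])
        show "m = m - column n r + column n r"
        proof (rule poly_mapping_eqI)
          fix i
          have "Poly_Mapping.lookup (column n r) i \<le> Poly_Mapping.lookup m i"
          proof (cases "n \<le> i \<and> i < n + r")
            case True
            then have "i - n < r" "n + (i - n) = i"
              by linarith+
            then have "Poly_Mapping.lookup m i \<noteq> 0"
              using pos [of "i - n"] by argo
            then show ?thesis
              by (simp add: lookup_column)
          qed (auto simp: lookup_column)
          then show "Poly_Mapping.lookup m i = Poly_Mapping.lookup (m - column n r + column n r) i"
            by (simp add: lookup_add lookup_minus)
        qed
        show "dominant n (m - column n r)"
        proof (rule dominantI)
          fix i j :: nat assume "i \<le> j"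
          then have "Poly_Mapping.lookup m (n + j) \<le> Poly_Mapping.lookup m (n + i)"
            by (rule dominantD [OF less.prems])
          moreover have "Poly_Mapping.lookup m (n + j) = 0" if "r \<le> j"
            using dominantD [OF less.prems that] r0 by simp
          ultimately show "Poly_Mapping.lookup (m - column n r) (n + j)
              \<le> Poly_Mapping.lookup (m - column n r) (n + i)"
            using \<open>i \<le> j\<close> by (cases "j < r") (simp_all add: lookup_minus lookup_column)
        qed
        show "esym r \<in> H"
          using H(3) by (rule subsetD) (use \<open>r \<noteq> 0\<close> in simp)
      qed (use \<open>r \<noteq> 0\<close> in \<open>simp_all add: mon_degree_column degree_le_esym tail_symmetric_esym leading_esym\<close>)
    qed
  qed
qed

lemma tail_symmetric_in_subalgebra:
  fixes H :: "(nat, 'a::field) mfps set"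
  assumes H: "subalgebra H" "range mvar \<subseteq> H" "esym ` {1..} \<subseteq> H"
    and F: "tail_symmetric n F" "degree_le d F"
  shows "F \<in> H"
proof -
  define D where "D = {m. dominant n m \<and> mon_degree m \<le> d}"
  (* Induction on a set U of dominant monomials that contains all those occurring in F. As U is
     closed under passing to smaller tails, subtracting a product whose leading monomial m has
     maximal tail in U removes m from U and introduces no dominant monomial outside U. *)
  have "F \<in> H" if "finite U" "U \<subseteq> D" "\<And>m m'. m \<in> U \<Longrightarrow> m' \<in> D \<Longrightarrow> tail n m' < tail n m \<Longrightarrow> m' \<in> U"
    "tail_symmetric n F" "degree_le d F" "\<And>m. m \<in> D - U \<Longrightarrow> mcoeff F m = 0" for U F
    using that
  proof (induction U arbitrary: F rule: finite_psubset_induct)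
    case (psubset U)
    note down = psubset.prems(2) and F = psubset.prems(3,4) and supp = psubset.prems(5)
    show ?case
    proof (cases "U = {}")
      case True
      then have "F = 0"
        using supp by (intro tail_symmetric_eq_0 [OF F]) (simp add: D_def)
      then show ?thesis
        using subalgebraD(1) [OF H(1)] by simp
    next
      case False
      then have "Max (tail n ` U) \<in> tail n ` U"
        using \<open>finite U\<close> by (intro Max_in) auto
      then obtain m where m: "m \<in> U" "tail n m = Max (tail n ` U)"
        by auto
      have max: "\<not> tail n m < tail n m'" if "m' \<in> U" for m'
        unfolding m(2) not_less using that \<open>finite U\<close> by (intro Max_ge) auto
      have "dominant n m" "mon_degree m \<le> d"
        using m(1) psubset.prems(1) by (auto simp: D_def)
      then obtain B where B: "B \<in> H" "tail_symmetric n B" "degree_le d B" "leading n m B"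
        using ex_leading_at_dominant [OF H, of n m] degree_le_mono [of "mon_degree m" _ d] by blast
      let ?c = "mcoeff F m"
      have "F - mscale ?c B \<in> H"
      proof (rule psubset.IH [of "U - {m}"])
        show "U - {m} \<subset> U" "U - {m} \<subseteq> D"
          using m(1) psubset.prems(1) by auto
        show "a' \<in> U - {m}" if "a \<in> U - {m}" "a' \<in> D" "tail n a' < tail n a" for a a'
          using that down max by blast
        show "tail_symmetric n (F - mscale ?c B)"
          using F B by (intro tail_symmetric_diff tail_symmetric_mscale)
        show "degree_le d (F - mscale ?c B)"
          using F B by (intro degree_le_diff degree_le_mscale)
        fix a assume a: "a \<in> D - (U - {m})"
        show "mcoeff (F - mscale ?c B) a = 0"
        proof (cases "a = m")
          case True
          then show ?thesis
            using leading_coeff [OF B(4)] by simp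
        next
          case False
          then have "a \<notin> U" "mcoeff F a = 0"
            using a supp by auto
          then have "mcoeff B a = 0"
            using leading_less [OF B(4), of a] down [OF m(1)] a False by blast
          then show ?thesis
            using \<open>mcoeff F a = 0\<close> by simp
        qed
      qed
      moreover have "mscale ?c B \<in> H"
        by (rule subalgebraD(5) [OF H(1) B(1)])
      ultimately have "F - mscale ?c B + mscale ?c B \<in> H"
        by (rule subalgebraD(3) [OF H(1)])
      then show ?thesis
        by simp
    qed
  qed
  moreover have "finite D"
    unfolding D_def by (rule finite_dominant)
  ultimately show ?thesis
    using F by blast
qed

lemma subalgebra_hull: "subalgebra (subalgebra hull S)"
  by (rule hull_in) (auto simp: subalgebra_def mfps.subspace_def)

lemma hull_mvar_esym: "subalgebra hull (range mvar \<union> esym ` {1..}) = ev_sym"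
proof
  have "mvar i \<in> ev_sym" for i
    by (rule ev_symI [OF degree_le_basic(3) tail_symmetric_mvar [OF lessI]])
  moreover have "esym r \<in> ev_sym" for r
    by (rule ev_symI [OF degree_le_esym tail_symmetric_esym])
  ultimately show "subalgebra hull (range mvar \<union> esym ` {1..}) \<subseteq> ev_sym"
    by (intro hull_minimal subalgebra_ev_sym) auto
  have gen: "range mvar \<union> esym ` {1..} \<subseteq> subalgebra hull (range mvar \<union> esym ` {1..})"
    by (rule hull_subset)
  show "ev_sym \<subseteq> subalgebra hull (range mvar \<union> esym ` {1..})"
  proof
    fix F :: "(nat, rat) mfps" assume F: "F \<in> ev_sym"
    obtain d n where "degree_le d F" "tail_symmetric n F"
      using ev_symE2 [OF F F] .
    then show "F \<in> subalgebra hull (range mvar \<union> esym ` {1..})"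
      using gen by (intro tail_symmetric_in_subalgebra [OF subalgebra_hull]) auto
  qed
qed

theorem proposition2p4:
  shows "algebraically_independent (UNIV <+> {1..})
           (case_sum mvar esym :: nat + nat \<Rightarrow> (nat, rat) mfps)
       \<and> subalgebra hull (range mvar \<union> esym ` {1..}) = ev_sym
       \<and> (invariant_under Sym_N ev_sym \<and> invariant_under Sym_inf ev_sym)
       \<and> (\<forall>V. mfps.subspace V \<and> V \<subseteq> ev_sym \<longrightarrow>
           (invariant_under Sym_inf V \<longleftrightarrow> invariant_under Sym_N V))"
  using algebraically_independent_mvar_esym hull_mvar_esym invariant_under_Sym_N_ev_sym
    invariant_under_Sym_N_iff by blast

end
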